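(* Let $X$ be a ball quasi-Banach function space on $\mathbb{R}^n$, $q\in(0,\infty)$, and $\gamma\in\mathbb{R}\setminus\{0\}$. For every $f\in C^1(\mathbb{R}^n)$ with $|\nabla f|\in C_{\mathrm c}(\mathbb{R}^n)$: (i) if $\gamma\in(0,\infty)$, then $$\liminf_{\lambda\to\infty}\lambda\left\|\left[\int_{\mathbb{R}^n}\mathbf{1}_{E_{\lambda,\gamma/q}[f]}(\cdot,y)|\cdot-y|^{\gamma-n}dy\right]^{1/q}\right\|_X\ge\left[\frac{\kappa(q,n)}{\gamma}\right]^{1/q}\|\,|\nabla f|\,\|_X;$$ (ii) if $\gamma\in(-\infty,0)$, then $$\liminf_{\lambda\to0^+}\lambda\left\|\left[\int_{\mathbb{R}^n}\mathbf{1}_{E_{\lambda,\gamma/q}[f]}(\cdot,y)|\cdot-y|^{\gamma-n}dy\right]^{1/q}\right\|_X\ge\left[-\frac{\kappa(q,n)}{\gamma}\right]^{1/q}\|\,|\nabla f|\,\|_X.$$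
   Context: A quasi-Banach space $X$ of measurable functions on $\mathbb{R}^n$, equipped with a quasi-norm $\|\cdot\|_X$ defined for all measurable functions, is a ball quasi-Banach function space if: (1) $\|f\|_X=0$ implies $f=0$ a.e.; (2) $|g|\le|f|$ a.e. implies $\|g\|_X\le\|f\|_X$; (3) $0\le f_m\uparrow f$ a.e. implies $\|f_m\|_X\uparrow\|f\|_X$; (4) $\mathbf{1}_B\in X$ for every ball $B$. $E_{\lambda,\beta}[f]:=\{(x,y):x\ne y,\ |f(x)-f(y)|/|x-y|^{1+\beta}>\lambda\}$. $\kappa(q,n):=\int_{\mathbb{S}^{n-1}}|e\cdot\omega|^q\,d\omega$ for any unit vector $e$. *)

theory Defs
  imports "HOL-Analysis.Analysis"
begin

definition meas_funs :: "('a::euclidean_space \<Rightarrow> real) set" where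
  "meas_funs = borel_measurable lebesgue"

definition qspace :: "(('a::euclidean_space \<Rightarrow> real) \<Rightarrow> ennreal) \<Rightarrow> ('a \<Rightarrow> real) set" where
  "qspace N = {f \<in> meas_funs. N f < \<infinity>}"

text \<open>Ball quasi-Banach function space, given through its quasi-norm N
  (defined for all measurable functions, with values in [0,\<infinity>]).\<close>
definition ball_qBfs :: "(('a::euclidean_space \<Rightarrow> real) \<Rightarrow> ennreal) \<Rightarrow> bool" where
  "ball_qBfs N \<longleftrightarrow>
     \<comment> \<open>quasi-norm on X: homogeneity and quasi-triangle inequality\<close>
     (\<forall>f\<in>qspace N. \<forall>c::real. N (\<lambda>x. c * f x) = ennreal \<bar>c\<bar> * N f) \<and>
     (\<exists>K::real\<ge>1. \<forall>f\<in>qspace N. \<forall>g\<in>qspace N. N (\<lambda>x. f x + g x) \<le> ennreal K * (N f + N g)) \<and>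
     \<comment> \<open>completeness\<close>
     (\<forall>s::nat \<Rightarrow> 'a \<Rightarrow> real. (\<forall>m. s m \<in> qspace N) \<and>
        (\<forall>e>0. \<exists>M. \<forall>m\<ge>M. \<forall>k\<ge>M. N (\<lambda>x. s m x - s k x) < ennreal e)
        \<longrightarrow> (\<exists>g\<in>qspace N. (\<lambda>m. N (\<lambda>x. s m x - g x)) \<longlonglongrightarrow> 0)) \<and>
     \<comment> \<open>(1)\<close>
     (\<forall>f\<in>meas_funs. N f = 0 \<longrightarrow> (AE x in lebesgue. f x = 0)) \<and>
     \<comment> \<open>(2)\<close>
     (\<forall>f\<in>meas_funs. \<forall>g\<in>meas_funs.
        (AE x in lebesgue. \<bar>g x\<bar> \<le> \<bar>f x\<bar>) \<longrightarrow> N g \<le> N f) \<and>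
     \<comment> \<open>(3) Fatou property\<close>
     (\<forall>fs f. (\<forall>m. fs m \<in> meas_funs) \<and> f \<in> meas_funs \<and>
        (AE x in lebesgue. (\<forall>m. 0 \<le> fs m x \<and> fs m x \<le> fs (Suc m) x) \<and>
                           (\<lambda>m. fs m x) \<longlonglongrightarrow> f x)
        \<longrightarrow> (\<lambda>m. N (fs m)) \<longlonglongrightarrow> N f) \<and>
     \<comment> \<open>(4)\<close>
     (\<forall>x r. N (indicator (ball x r)) < \<infinity>)"

text \<open>Surface measure on the unit sphere S^{n-1}, defined as the cone measure:
  sigma(A) = n * |{t w : 0 < t < 1, w \<in> A}|.\<close>
definition sphere_measure :: "'a::euclidean_space measure" where
  "sphere_measure = scale_measure (of_nat DIM('a))
     (distr (density lborel (indicator (ball 0 1 - {0}))) borel (\<lambda>x. x /\<^sub>R norm x))"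

definition kappa :: "real \<Rightarrow> 'a::euclidean_space itself \<Rightarrow> real" where
  "kappa q _ = (let e = (SOME e::'a. e \<in> Basis) in
      integral\<^sup>L (sphere_measure :: 'a measure) (\<lambda>w. \<bar>e \<bullet> w\<bar> powr q))"

definition Eset :: "real \<Rightarrow> real \<Rightarrow> ('a::euclidean_space \<Rightarrow> real) \<Rightarrow> ('a \<times> 'a) set" where
  "Eset lam beta f = {(x, y). x \<noteq> y \<and> \<bar>f x - f y\<bar> / norm (x - y) powr (1 + beta) > lam}"

definition Efun :: "real \<Rightarrow> real \<Rightarrow> real \<Rightarrow> ('a::euclidean_space \<Rightarrow> real) \<Rightarrow> 'a \<Rightarrow> real" where
  "Efun lam gam q f x =
     enn2real (\<integral>\<^sup>+ y. indicator (Eset lam (gam / q) f) (x, y)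
                       * ennreal (norm (x - y) powr (gam - real DIM('a))) \<partial>lborel) powr (1 / q)"

end

theory Submission
  imports Defs
begin

text \<open>
  Put lam = t powr (- gam / q), so that the limit in lam becomes the limit t to 0 from the right for either sign of gam.
  The substitution y = x + t u turns the q-th power of lam times the inner function at x into the integral
  over u of norm u powr (gam - n), restricted to norm u powr (1 + gam / q) < |f (x + t u) - f x| / t. By Fatou's lemma
  its lower limit is at least the same integral restricted to norm u powr (1 + gam / q) < |grad f x . u|,
  which polar coordinates and rotation invariance evaluate to kappa |grad f x| powr q / |gam|.
  The Fatou property of the quasi-norm transfers this pointwise bound to N.
\<close>

section \<open>Affine and orthogonal changes of variables for Lebesgue measure\<close>

lemma nn_integral_lborel_affine:
  fixes f :: "'a::euclidean_space \<Rightarrow> ennreal"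
  assumes [measurable]: "f \<in> borel_measurable borel" and c: "c \<noteq> 0"
  shows "(\<integral>\<^sup>+x. f x \<partial>lborel) = ennreal (\<bar>c\<bar> ^ DIM('a)) * (\<integral>\<^sup>+x. f (t + c *\<^sub>R x) \<partial>lborel)"
  by (subst lborel_affine[OF c, of t])
     (simp add: nn_integral_density nn_integral_distr nn_integral_cmult)

text \<open>The argument for uniqueness of Haar measure: lborel and its image under T are both translation invariant,
  hence proportional, and they agree on the unit ball.\<close>

lemma nn_integral_lborel_orthogonal_transformation:
  fixes f :: "'a::euclidean_space \<Rightarrow> ennreal"
  assumes [measurable]: "f \<in> borel_measurable borel" and T: "orthogonal_transformation (T :: 'a \<Rightarrow> 'a)"
  shows "(\<integral>\<^sup>+x. f (T x) \<partial>lborel) = (\<integral>\<^sup>+x. f x \<partial>lborel)"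
proof -
  have lin: "linear T" and nT: "norm (T x) = norm x" for x
    using T by (auto simp: orthogonal_transformation_linear orthogonal_transformation_norm)
  have surj: "surj T"
    using lin T by (intro linear_injective_imp_surjective orthogonal_transformation_inj) auto
  have [measurable]: "T \<in> borel_measurable borel"
    using lin by (simp add: borel_measurable_continuous_onI linear_continuous_on linear_conv_bounded_linear)
  \<comment> \<open>This weight is invariant under \<open>T\<close>, and its integral, the volume of
    the unit ball, is positive and finite, so it can be cancelled at the end.\<close>
  define k :: "'a \<Rightarrow> ennreal" where "k = indicator (ball 0 1)"
  have [measurable]: "k \<in> borel_measurable borel"
    unfolding k_def by (intro borel_measurable_indicator) auto
  have kT: "k (T x) = k x" for x
    by (simp add: k_def nT indicator_def)
  have shift: "(\<integral>\<^sup>+x. g x \<partial>lborel) = (\<integral>\<^sup>+x. g (t + x) \<partial>lborel)"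
    if "g \<in> borel_measurable borel" for g :: "'a \<Rightarrow> ennreal" and t
    using nn_integral_lborel_affine[OF that, of 1 t] by simp
  have "(\<integral>\<^sup>+x. k x \<partial>lborel) * (\<integral>\<^sup>+y. f (T y) \<partial>lborel) = (\<integral>\<^sup>+y. (\<integral>\<^sup>+x. k x * f (T y) \<partial>lborel) \<partial>lborel)"
    by (simp add: nn_integral_multc nn_integral_cmult)
  also have "\<dots> = (\<integral>\<^sup>+y. (\<integral>\<^sup>+x. k (T y + x) * f (T y) \<partial>lborel) \<partial>lborel)"
  proof (rule nn_integral_cong)
    fix y
    show "(\<integral>\<^sup>+x. k x * f (T y) \<partial>lborel) = (\<integral>\<^sup>+x. k (T y + x) * f (T y) \<partial>lborel)"
      by (rule shift) measurable
  qed
  also have "\<dots> = (\<integral>\<^sup>+x. (\<integral>\<^sup>+y. k (T y + x) * f (T y) \<partial>lborel) \<partial>lborel)"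
    by (rule lborel_pair.Fubini') measurable
  also have "\<dots> = (\<integral>\<^sup>+x. (\<integral>\<^sup>+y. k (T y) * f (T y - x) \<partial>lborel) \<partial>lborel)"
  proof (rule nn_integral_cong)
    fix x
    \<comment> \<open>Translating \<open>y\<close> by \<open>- z\<close> moves \<open>T y\<close> by
      \<open>- x\<close>; this is how translation invariance passes through
      \<open>T\<close>.\<close>
    obtain z where z: "T z = x" using surj by (metis surjD)
    show "(\<integral>\<^sup>+y. k (T y + x) * f (T y) \<partial>lborel) = (\<integral>\<^sup>+y. k (T y) * f (T y - x) \<partial>lborel)"
      by (subst shift[where t="- z"]) (auto simp: linear_add[OF lin] linear_neg[OF lin] linear_diff[OF lin] z)
  qed
  also have "\<dots> = (\<integral>\<^sup>+y. (\<integral>\<^sup>+x. k (T y) * f (T y - x) \<partial>lborel) \<partial>lborel)"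
    by (rule lborel_pair.Fubini') measurable
  also have "\<dots> = (\<integral>\<^sup>+y. k y * (\<integral>\<^sup>+x. f x \<partial>lborel) \<partial>lborel)"
  proof (rule nn_integral_cong)
    fix y
    have "(\<integral>\<^sup>+x. f x \<partial>lborel) = (\<integral>\<^sup>+x. f (T y - x) \<partial>lborel)"
      using nn_integral_lborel_affine[of f "-1" "T y"] by simp
    then show "(\<integral>\<^sup>+x. k (T y) * f (T y - x) \<partial>lborel) = k y * (\<integral>\<^sup>+x. f x \<partial>lborel)"
      by (simp add: nn_integral_cmult kT)
  qed
  also have "\<dots> = (\<integral>\<^sup>+x. k x \<partial>lborel) * (\<integral>\<^sup>+x. f x \<partial>lborel)"
    by (simp add: nn_integral_multc)
  finally have eq: "emeasure lborel (ball (0::'a) 1) * (\<integral>\<^sup>+y. f (T y) \<partial>lborel)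
      = emeasure lborel (ball (0::'a) 1) * (\<integral>\<^sup>+x. f x \<partial>lborel)"
    by (simp add: k_def)
  have fin: "emeasure lborel (ball (0::'a) 1) \<noteq> top"
    using emeasure_bounded_finite[of "ball (0::'a) 1"] by (simp add: less_top)
  moreover have "emeasure lborel (ball (0::'a) 1) \<noteq> 0"
    using content_ball_pos[of 1 "0::'a"] emeasure_eq_ennreal_measure[OF fin] by simp
  ultimately show ?thesis
    using eq by (simp add: ennreal_mult_cancel_left)
qed

text \<open>Since \<open>a\<close> and \<open>b\<close> have equal norm, the reflection in the
  hyperplane orthogonal to \<open>a - b\<close> swaps them. The case \<open>a = b\<close> is
  separate because the reflection formula divides by \<open>w \<bullet> w\<close>.\<close>

lemma orthogonal_transformation_maps_unit_vectors:
  fixes a b :: "'a::euclidean_space"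
  assumes "norm a = 1" "norm b = 1"
  obtains T :: "'a \<Rightarrow> 'a" where "orthogonal_transformation T" "T a = b"
proof (cases "a = b")
  case True
  then show ?thesis using that[of "\<lambda>x. x"] by (simp add: orthogonal_transformation_def linear_id[unfolded id_def])
next
  case False
  define w where "w = a - b"
  have w0: "w \<bullet> w \<noteq> 0" using False by (simp add: w_def)
  define T :: "'a \<Rightarrow> 'a" where "T x = x - (2 * (x \<bullet> w) / (w \<bullet> w)) *\<^sub>R w" for x
  have "linear T"
    by (rule linearI) (simp_all add: T_def algebra_simps inner_add_left add_divide_distrib)
  moreover have "T x \<bullet> T y = x \<bullet> y" for x y
    using w0 by (simp add: T_def inner_diff_left inner_diff_right inner_commute field_simps)
  moreover have "T a = b"
  proof -
    have "a \<bullet> a = 1" "b \<bullet> b = 1" using assms by (simp_all add: dot_square_norm)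
    \<comment> \<open>Equality of the norms makes the coefficient of \<open>w\<close> in
      \<open>T a\<close> equal to 1, so that \<open>T a = a - w = b\<close>.\<close>
    then have "2 * (a \<bullet> w) = w \<bullet> w"
      by (simp add: w_def inner_diff_left inner_diff_right inner_commute)
    then show ?thesis using w0 by (simp add: T_def w_def)
  qed
  ultimately show ?thesis using that by (auto simp: orthogonal_transformation_def)
qed

section \<open>The cone measure on the sphere and polar coordinates\<close>

lemma nn_integral_sphere_measure:
  fixes h :: "'a::euclidean_space \<Rightarrow> ennreal"
  assumes [measurable]: "h \<in> borel_measurable borel"
  shows "(\<integral>\<^sup>+w. h w \<partial>sphere_measure)
    = of_nat DIM('a) * (\<integral>\<^sup>+v. indicator (ball 0 1 - {0}) v * h (v /\<^sub>R norm v) \<partial>lborel)"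
proof -
  have "(\<lambda>v::'a. v /\<^sub>R norm v) \<in> density lborel (indicator (ball 0 1 - {0})) \<rightarrow>\<^sub>M borel"
    by measurable
  moreover have "(indicator (ball 0 1 - {0}) :: 'a \<Rightarrow> ennreal) \<in> borel_measurable borel"
    by (intro borel_measurable_indicator) auto
  ultimately show ?thesis
    unfolding sphere_measure_def
    by (subst nn_integral_scale_measure, simp, subst nn_integral_distr, simp, simp,
        subst nn_integral_density) (simp_all add: o_def)
qed

text \<open>Normalising constant for the averaging argument in polar coordinates. The factor
  \<open>inverse s\<close> arises there from a radial substitution and
  \<open>inverse (s ^ n)\<close> from scaling the space variable, so the two are kept apart.\<close>

lemma nn_integral_inverse_power_Suc:
  "(\<integral>\<^sup>+s. indicator {1<..} s * ennreal (inverse s * inverse (s ^ n)) \<partial>lborel) * of_nat n = (1::ennreal)"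
  if "0 < n"
proof -
  have "(\<integral>\<^sup>+s. indicator {1<..} s * ennreal (inverse s * inverse (s ^ n)) \<partial>lborel)
     = (\<integral>\<^sup>+s. ennreal (s powr (- real n - 1)) * indicator {1..} s \<partial>lborel)"
  proof (rule nn_integral_cong_AE)
    have "AE s in lborel. s \<noteq> (1::real)"
      by (rule AE_lborel_singleton)
    then show "AE s in lborel. indicator {1<..} s * ennreal (inverse s * inverse (s ^ n))
        = ennreal (s powr (- real n - 1)) * indicator {1..} s"
      by eventually_elim
        (auto simp: indicator_def powr_diff powr_minus powr_realpow field_simps)
  qed
  also have "\<dots> = ennreal (1 / real n)"
    using nn_integral_has_integral_lebesgue'[OF _ has_integral_powr_to_inf[of "- real n - 1" 1]] that
    by simp
  finally show ?thesis using that
    by (simp add: ennreal_of_nat_eq_real_of_nat ennreal_mult[symmetric])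
qed

text \<open>Polar coordinates for the cone measure: by scaling and Fubini, averaging the right-hand side over the
  radius of the ball that defines the sphere measure yields the left-hand side times
  the integral of n / s^(n+1) over s > 1, which is 1.\<close>

lemma nn_integral_polar:
  fixes \<Phi> :: "real \<Rightarrow> 'a::euclidean_space \<Rightarrow> ennreal"
  assumes [measurable]: "case_prod \<Phi> \<in> borel_measurable (borel \<Otimes>\<^sub>M borel)"
  shows "(\<integral>\<^sup>+x. \<Phi> (norm x) (x /\<^sub>R norm x) \<partial>lborel)
    = (\<integral>\<^sup>+w. (\<integral>\<^sup>+r. indicator {0<..} r * ennreal (r ^ (DIM('a) - 1)) * \<Phi> r w \<partial>lborel) \<partial>sphere_measure)"
proof -
  define n where "n = DIM('a)"
  have n: "0 < n" by (simp add: n_def)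
  \<comment> \<open>\<open>\<Psi> r\<close> is constant on open rays from the origin and thus
    survives every rescaling below. The value 0 at the origin accounts for the point removed from
    the ball and makes the case \<open>u = 0\<close> trivial.\<close>
  define \<Psi> where "\<Psi> r u = (if u = 0 then 0 else \<Phi> r (u /\<^sub>R norm u))" for r u
  have [measurable]: "case_prod \<Psi> \<in> borel_measurable (borel \<Otimes>\<^sub>M borel)"
    unfolding \<Psi>_def by measurable
  have \<Psi>_scale: "\<Psi> r (c *\<^sub>R u) = \<Psi> r u" if "0 < c" for r c u
  proof (cases "u = 0")
    case False
    have "(c *\<^sub>R u) /\<^sub>R norm (c *\<^sub>R u) = u /\<^sub>R norm u"
      using that by (simp add: field_simps)
    with False that show ?thesis
      unfolding \<Psi>_def by (simp del: norm_scaleR scaleR_scaleR)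
  qed (simp add: \<Psi>_def)
  define P where "P = (\<integral>\<^sup>+x. \<Psi> (norm x) x \<partial>lborel)"
  have P: "(\<integral>\<^sup>+x. \<Phi> (norm x) (x /\<^sub>R norm x) \<partial>lborel) = P"
    unfolding P_def
  proof (rule nn_integral_cong_AE)
    have "AE x in lborel. x \<noteq> (0::'a)" by (rule AE_lborel_singleton)
    then show "AE x::'a in lborel. \<Phi> (norm x) (x /\<^sub>R norm x) = \<Psi> (norm x) x"
      by eventually_elim (simp add: \<Psi>_def)
  qed
  have "(\<integral>\<^sup>+w. (\<integral>\<^sup>+r. indicator {0<..} r * ennreal (r ^ (n - 1)) * \<Phi> r w \<partial>lborel) \<partial>sphere_measure)
    = of_nat n * (\<integral>\<^sup>+v. (\<integral>\<^sup>+r. indicator {..<1} (norm v) * (indicator {0<..} r * ennreal (r ^ (n - 1)) * \<Psi> r v) \<partial>lborel) \<partial>lborel)"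
    unfolding n_def
    by (subst nn_integral_sphere_measure)
       (auto intro!: arg_cong2[where f="(*)"] nn_integral_cong simp: \<Psi>_def indicator_def)
  also have "(\<integral>\<^sup>+v. (\<integral>\<^sup>+r. indicator {..<1} (norm v) * (indicator {0<..} r * ennreal (r ^ (n - 1)) * \<Psi> r v) \<partial>lborel) \<partial>lborel)
    = (\<integral>\<^sup>+r. (\<integral>\<^sup>+v. indicator {..<1} (norm v) * (indicator {0<..} r * ennreal (r ^ (n - 1)) * \<Psi> r v) \<partial>lborel) \<partial>lborel)"
    by (rule lborel_pair.Fubini') measurable
  \<comment> \<open>For fixed \<open>r > 0\<close> substitute \<open>u = r *\<^sub>R v\<close>: the
    unit ball becomes the ball of radius \<open>r\<close>, and \<open>r ^ (n - 1)\<close> against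
    the Jacobian \<open>r ^ n\<close> leaves \<open>inverse r\<close>. For \<open>r \<le> 0\<close>
    both sides vanish.\<close>
  also have "\<dots> = (\<integral>\<^sup>+r. (\<integral>\<^sup>+u. (if norm u < r then ennreal (inverse r) * \<Psi> r u else 0) \<partial>lborel) \<partial>lborel)"
  proof (rule nn_integral_cong)
    fix r :: real
    show "(\<integral>\<^sup>+v. indicator {..<1} (norm v) * (indicator {0<..} r * ennreal (r ^ (n - 1)) * \<Psi> r v) \<partial>lborel)
       = (\<integral>\<^sup>+u. (if norm u < r then ennreal (inverse r) * \<Psi> r u else 0) \<partial>lborel)"
    proof (cases "0 < r")
      case True
      have "(\<integral>\<^sup>+u. (if norm u < r then ennreal (inverse r) * \<Psi> r u else 0) \<partial>lborel)
         = ennreal (r ^ n) * (\<integral>\<^sup>+u. (if norm (r *\<^sub>R u) < r then ennreal (inverse r) * \<Psi> r (r *\<^sub>R u) else 0) \<partial>lborel)"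
        using True by (subst nn_integral_lborel_affine[where c=r and t=0]) (simp_all add: n_def cong: if_cong)
      also have "\<dots> = (\<integral>\<^sup>+u. ennreal (r ^ n) * ((if norm (r *\<^sub>R u) < r then ennreal (inverse r) * \<Psi> r (r *\<^sub>R u) else 0)) \<partial>lborel)"
        by (rule nn_integral_cmult[symmetric]) measurable
      also have "\<dots> = (\<integral>\<^sup>+v. indicator {..<1} (norm v) * (indicator {0<..} r * ennreal (r ^ (n - 1)) * \<Psi> r v) \<partial>lborel)"
      proof (rule nn_integral_cong)
        fix u :: 'a
        have "ennreal (r ^ (n - 1)) = ennreal (r ^ n) * ennreal (inverse r)"
          using True n by (simp add: ennreal_mult[symmetric] power_diff divide_inverse)
        then show "ennreal (r ^ n) * ((if norm (r *\<^sub>R u) < r then ennreal (inverse r) * \<Psi> r (r *\<^sub>R u) else 0))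
           = indicator {..<1} (norm u) * (indicator {0<..} r * ennreal (r ^ (n - 1)) * \<Psi> r u)"
          using True by (auto simp: indicator_def \<Psi>_scale mult.assoc)
      qed
      finally show ?thesis by simp
    next
      case False
      then have "\<not> norm u < r" for u :: 'a
        using norm_ge_zero[of u] by linarith
      with False show ?thesis by (simp add: indicator_def)
    qed
  qed
  also have "\<dots> = (\<integral>\<^sup>+u. (\<integral>\<^sup>+r. (if norm u < r then ennreal (inverse r) * \<Psi> r u else 0) \<partial>lborel) \<partial>lborel)"
    by (rule lborel_pair.Fubini') measurable
  \<comment> \<open>For fixed \<open>u \<noteq> 0\<close> substitute \<open>r = norm u * s\<close>.
    The measure dr/r is invariant under this scaling, and the domain becomes s > 1, independent of
    \<open>u\<close>.\<close>
  also have "\<dots> = (\<integral>\<^sup>+u. (\<integral>\<^sup>+s. indicator {1<..} s * ennreal (inverse s) * \<Psi> (norm u * s) u \<partial>lborel) \<partial>lborel)"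
  proof (rule nn_integral_cong)
    fix u :: 'a
    show "(\<integral>\<^sup>+r. (if norm u < r then ennreal (inverse r) * \<Psi> r u else 0) \<partial>lborel)
        = (\<integral>\<^sup>+s. indicator {1<..} s * ennreal (inverse s) * \<Psi> (norm u * s) u \<partial>lborel)"
    proof (cases "u = 0")
      case False
      have "(\<integral>\<^sup>+r. (if norm u < r then ennreal (inverse r) * \<Psi> r u else 0) \<partial>lborel)
         = ennreal (norm u) * (\<integral>\<^sup>+s. (if norm u < norm u * s then ennreal (inverse (norm u * s)) * \<Psi> (norm u * s) u else 0) \<partial>lborel)"
        using False by (subst nn_integral_real_affine[where c="norm u" and t=0]) (simp_all cong: if_cong)
      also have "\<dots> = (\<integral>\<^sup>+s. ennreal (norm u) * ((if norm u < norm u * s then ennreal (inverse (norm u * s)) * \<Psi> (norm u * s) u else 0)) \<partial>lborel)"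
        by (rule nn_integral_cmult[symmetric]) measurable
      also have "\<dots> = (\<integral>\<^sup>+s. indicator {1<..} s * ennreal (inverse s) * \<Psi> (norm u * s) u \<partial>lborel)"
      proof (rule nn_integral_cong)
        fix s :: real
        have "ennreal (norm u) * ennreal (inverse (norm u * s)) = ennreal (inverse s)" if "1 < s"
          using that False by (subst ennreal_mult[symmetric]) (simp_all add: field_simps)
        then show "ennreal (norm u) * ((if norm u < norm u * s then ennreal (inverse (norm u * s)) * \<Psi> (norm u * s) u else 0))
          = indicator {1<..} s * ennreal (inverse s) * \<Psi> (norm u * s) u"
          using False by (auto simp: indicator_def mult.assoc[symmetric])
      qed
      finally show ?thesis .
    qed (simp add: \<Psi>_def cong: if_cong)
  qed
  also have "\<dots> = (\<integral>\<^sup>+s. (\<integral>\<^sup>+u. indicator {1<..} s * ennreal (inverse s) * \<Psi> (norm u * s) u \<partial>lborel) \<partial>lborel)"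
    by (rule lborel_pair.Fubini') measurable
  \<comment> \<open>Replacing \<open>u\<close> by \<open>inverse s *\<^sub>R u\<close> turns the
    radius \<open>norm u * s\<close> into \<open>norm u\<close> at the cost of the factor
    \<open>inverse (s ^ n)\<close>, and keeps the direction; what remains is
    \<open>P\<close>.\<close>
  also have "\<dots> = (\<integral>\<^sup>+s. indicator {1<..} s * ennreal (inverse s * inverse (s ^ n)) * P \<partial>lborel)"
  proof (rule nn_integral_cong)
    fix s :: real
    show "(\<integral>\<^sup>+u. indicator {1<..} s * ennreal (inverse s) * \<Psi> (norm u * s) u \<partial>lborel)
      = indicator {1<..} s * ennreal (inverse s * inverse (s ^ n)) * P"
    proof (cases "1 < s")
      case True
      have "(\<integral>\<^sup>+u. \<Psi> (norm u * s) u \<partial>lborel)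
        = ennreal (inverse (s ^ n)) * (\<integral>\<^sup>+u. \<Psi> (norm (inverse s *\<^sub>R u) * s) (inverse s *\<^sub>R u) \<partial>lborel)"
        using True by (subst nn_integral_lborel_affine[where c="inverse s" and t=0])
          (simp_all add: n_def power_inverse)
      also have "\<dots> = ennreal (inverse (s ^ n)) * P"
      proof -
        have "norm (inverse s *\<^sub>R u) * s = norm u" for u :: 'a
          using True by simp
        then show ?thesis using True by (simp add: P_def \<Psi>_scale del: norm_scaleR)
      qed
      finally show ?thesis
        using True by (simp add: nn_integral_cmult ennreal_mult mult.assoc)
    qed (simp add: indicator_def)
  qed
  also have "\<dots> = (\<integral>\<^sup>+s. indicator {1<..} s * ennreal (inverse s * inverse (s ^ n)) \<partial>lborel) * P"
    by (rule nn_integral_multc) measurable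
  also have "of_nat n * \<dots>
    = ((\<integral>\<^sup>+s. indicator {1<..} s * ennreal (inverse s * inverse (s ^ n)) \<partial>lborel) * of_nat n) * P"
    by (simp only: ac_simps)
  also have "\<dots> = P"
    by (simp only: nn_integral_inverse_power_Suc[OF n] mult_1)
  finally show ?thesis
    unfolding P n_def by simp
qed

section \<open>Integrals of powers over superlevel sets\<close>

text \<open>For a > 0 the threshold is b = a^(q/gam): the set is 0 < r < b when gam > 0 and r > b
  when gam < 0. In both cases the integral of r^(gam-1) is b^gam / |gam|, and b^gam = a^q. This is
  where the two signs of \<open>gam\<close> are unified.\<close>

lemma nn_integral_powr_superlevel:
  fixes q gam a :: real
  assumes q: "0 < q" and gam: "gam \<noteq> 0" and a: "0 \<le> a"
  shows "(\<integral>\<^sup>+r. ennreal (r powr (gam - 1)) * indicator {r. 0 < r \<and> r powr (gam / q) < a} r \<partial>lborel)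
    = ennreal (a powr q / \<bar>gam\<bar>)"
proof (cases "a = 0")
  case True
  have "\<not> r powr (gam / q) < 0" for r :: real
    by (simp add: not_less)
  then show ?thesis using True q by simp
next
  case False
  then have a: "0 < a" using a by simp
  define b where "b = a powr (q / gam)"
  have b: "0 < b" using a by (simp add: b_def)
  have ab: "a = b powr (gam / q)" and bq: "b powr gam = a powr q"
    using a q gam by (simp_all add: b_def powr_powr)
  \<comment> \<open>Off the null set {0, b} the strict superlevel set agrees with
    \<open>{0..b}\<close> or with \<open>{b..}\<close>, over which the power integrals are
    known.\<close>
  have AE: "AE r in lborel. r \<noteq> 0 \<and> r \<noteq> b"
    using AE_lborel_singleton[of 0] AE_lborel_singleton[of b] by eventually_elim simp
  show ?thesis
  proof (cases "0 < gam")
    case True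
    then have "0 < gam / q" using q by simp
    then have lt: "r powr (gam / q) < a \<longleftrightarrow> r < b" if "0 < r" for r
      using powr_less_mono2[of "gam / q" r b] powr_mono2[of "gam / q" b r] that b
      unfolding ab by fastforce
    have "(\<integral>\<^sup>+r. ennreal (r powr (gam - 1)) * indicator {r. 0 < r \<and> r powr (gam / q) < a} r \<partial>lborel)
       = (\<integral>\<^sup>+r. ennreal (r powr (gam - 1)) * indicator {0..b} r \<partial>lborel)"
      by (rule nn_integral_cong_AE, use AE in eventually_elim) (auto simp: indicator_def lt)
    also have "\<dots> = ennreal (b powr gam / gam)"
      using nn_integral_has_integral_lebesgue'[OF _ has_integral_powr_from_0[of "gam - 1" b]] True b
      by simp
    finally show ?thesis using True bq by simp
  next
    case False
    then have g: "gam < 0" using gam by simp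
    then have "gam / q < 0" using q by (simp add: divide_neg_pos)
    then have lt: "r powr (gam / q) < a \<longleftrightarrow> b < r" if "0 < r" for r
      using powr_less_mono2_neg[of "gam / q" b r] powr_mono2'[of "gam / q" r b] that b
      unfolding ab by fastforce
    have "(\<integral>\<^sup>+r. ennreal (r powr (gam - 1)) * indicator {r. 0 < r \<and> r powr (gam / q) < a} r \<partial>lborel)
       = (\<integral>\<^sup>+r. ennreal (r powr (gam - 1)) * indicator {b..} r \<partial>lborel)"
      by (rule nn_integral_cong_AE, insert b, use AE in eventually_elim) (auto simp: indicator_def lt)
    also have "\<dots> = ennreal (- (b powr gam) / gam)"
      using nn_integral_has_integral_lebesgue'[OF _ has_integral_powr_to_inf[of "gam - 1" b]] g b
      by simp
    finally show ?thesis using g bq by simp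
  qed
qed

text \<open>In polar coordinates the density r^(n-1) turns the weight r^(gam-n) into r^(gam-1), and
  for each direction the radial integral is the preceding one. The function \<open>\<theta>\<close>
  is left general to serve twice: as |g . w| for the main term and as a constant for
  finiteness.\<close>

lemma nn_integral_homogeneous_superlevel:
  fixes \<theta> :: "'a::euclidean_space \<Rightarrow> real"
  assumes q: "0 < q" and gam: "gam \<noteq> 0"
    and [measurable]: "\<theta> \<in> borel_measurable borel" and nonneg: "\<And>w. 0 \<le> \<theta> w"
  shows "(\<integral>\<^sup>+u. indicator {u. norm u powr (gam / q) < \<theta> (u /\<^sub>R norm u)} u
            * ennreal (norm u powr (gam - real DIM('a))) \<partial>lborel)
    = ennreal (1 / \<bar>gam\<bar>) * (\<integral>\<^sup>+w. ennreal (\<theta> w powr q) \<partial>sphere_measure)"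
proof -
  define \<Phi> where "\<Phi> r w = (if r powr (gam / q) < \<theta> w then ennreal (r powr (gam - real DIM('a))) else 0)"
    for r w
  have "(\<integral>\<^sup>+u. indicator {u. norm u powr (gam / q) < \<theta> (u /\<^sub>R norm u)} u
            * ennreal (norm u powr (gam - real DIM('a))) \<partial>lborel)
    = (\<integral>\<^sup>+u. \<Phi> (norm u) (u /\<^sub>R norm u) \<partial>lborel)"
    by (rule nn_integral_cong) (simp add: \<Phi>_def)
  also have "\<dots> = (\<integral>\<^sup>+w. (\<integral>\<^sup>+r. indicator {0<..} r * ennreal (r ^ (DIM('a) - 1)) * \<Phi> r w \<partial>lborel) \<partial>sphere_measure)"
    by (rule nn_integral_polar) (unfold \<Phi>_def, measurable)
  also have "\<dots> = (\<integral>\<^sup>+w. ennreal (1 / \<bar>gam\<bar>) * ennreal (\<theta> w powr q) \<partial>sphere_measure)"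
  proof (rule nn_integral_cong)
    fix w
    have "(\<integral>\<^sup>+r. indicator {0<..} r * ennreal (r ^ (DIM('a) - 1)) * \<Phi> r w \<partial>lborel)
      = (\<integral>\<^sup>+r. ennreal (r powr (gam - 1)) * indicator {r. 0 < r \<and> r powr (gam / q) < \<theta> w} r \<partial>lborel)"
    proof (rule nn_integral_cong)
      fix r :: real
      have "r ^ (DIM('a) - 1) * r powr (gam - real DIM('a)) = r powr (gam - 1)" if "0 < r"
      proof -
        have "r ^ (DIM('a) - 1) = r powr (real DIM('a) - 1)"
          using that by (simp add: powr_realpow[symmetric] of_nat_diff Suc_leI)
        then show ?thesis using that by (simp add: powr_add[symmetric])
      qed
      then show "indicator {0<..} r * ennreal (r ^ (DIM('a) - 1)) * \<Phi> r w
        = ennreal (r powr (gam - 1)) * indicator {r. 0 < r \<and> r powr (gam / q) < \<theta> w} r"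
        by (auto simp: \<Phi>_def indicator_def ennreal_mult[symmetric])
    qed
    also have "\<dots> = ennreal (1 / \<bar>gam\<bar>) * ennreal (\<theta> w powr q)"
      by (simp add: nn_integral_powr_superlevel[OF q gam nonneg] ennreal_mult[symmetric])
    finally show "(\<integral>\<^sup>+r. indicator {0<..} r * ennreal (r ^ (DIM('a) - 1)) * \<Phi> r w \<partial>lborel)
      = ennreal (1 / \<bar>gam\<bar>) * ennreal (\<theta> w powr q)" .
  qed
  also have "\<dots> = ennreal (1 / \<bar>gam\<bar>) * (\<integral>\<^sup>+w. ennreal (\<theta> w powr q) \<partial>sphere_measure)"
    by (rule nn_integral_cmult) (simp add: sphere_measure_def)
  finally show ?thesis .
qed

section \<open>Finiteness of the sphere measure and the constant \<open>kappa\<close>\<close>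

lemma finite_nn_integral_sphere_measure_const:
  "(\<integral>\<^sup>+w. ennreal c \<partial>(sphere_measure :: 'a::euclidean_space measure)) < \<infinity>"
proof -
  have "(\<integral>\<^sup>+v. indicator (ball (0::'a) 1 - {0}) v * ennreal c \<partial>lborel)
      \<le> (\<integral>\<^sup>+v. indicator (ball (0::'a) 1) v * ennreal c \<partial>lborel)"
    by (rule nn_integral_mono) (auto simp: indicator_def)
  also have "\<dots> = emeasure lborel (ball (0::'a) 1) * ennreal c"
    by (subst nn_integral_multc, intro borel_measurable_indicator) auto
  also have "\<dots> < \<infinity>"
    using emeasure_bounded_finite[of "ball (0::'a) 1"] by (simp add: ennreal_mult_less_top)
  finally show ?thesis
    by (subst nn_integral_sphere_measure) (simp_all add: ennreal_mult_less_top of_nat_less_top)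
qed

lemma kappa_nonneg: "0 \<le> kappa q TYPE('a::euclidean_space)"
  by (simp add: kappa_def Let_def integral_nonneg_AE)

text \<open>Homogeneity reduces \<open>g\<close> to a unit vector, and an orthogonal map carries
  that vector to the one chosen in \<open>kappa\<close>; the cone measure inherits rotation
  invariance from Lebesgue measure on the ball.\<close>

lemma nn_integral_sphere_measure_inner:
  fixes g :: "'a::euclidean_space"
  assumes q: "0 < q"
  shows "(\<integral>\<^sup>+w. ennreal (\<bar>g \<bullet> w\<bar> powr q) \<partial>(sphere_measure :: 'a measure))
    = ennreal (kappa q TYPE('a) * norm g powr q)"
proof -
  define e :: 'a where "e = (SOME e. e \<in> Basis)"
  have "e \<in> Basis" unfolding e_def by (rule SOME_Basis)
  then have e: "norm e = 1" by simp
  define I where "I h = (\<integral>\<^sup>+w. ennreal (\<bar>h \<bullet> w\<bar> powr q) \<partial>(sphere_measure :: 'a measure))" for h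
  have I: "I h = of_nat DIM('a) *
      (\<integral>\<^sup>+v. indicator (ball 0 1 - {0}) v * ennreal (\<bar>h \<bullet> (v /\<^sub>R norm v)\<bar> powr q) \<partial>lborel)" for h
    unfolding I_def by (rule nn_integral_sphere_measure) measurable
  \<comment> \<open>This bound makes \<open>I e\<close> finite, so that the real-valued integral
    defining \<open>kappa\<close> can be lifted back to the nonnegative integral
    \<open>I e\<close>.\<close>
  have le1: "ennreal (\<bar>e \<bullet> (v /\<^sub>R norm v)\<bar> powr q) \<le> ennreal 1" for v
  proof (rule ennreal_leI)
    have "\<bar>e \<bullet> (v /\<^sub>R norm v)\<bar> \<le> norm e * norm (v /\<^sub>R norm v)" by (rule Cauchy_Schwarz_ineq2)
    also have "\<dots> \<le> 1" by (cases "v = 0") (simp_all add: e)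
    finally show "\<bar>e \<bullet> (v /\<^sub>R norm v)\<bar> powr q \<le> 1"
      using powr_mono2[of q "\<bar>e \<bullet> (v /\<^sub>R norm v)\<bar>" 1] q by simp
  qed
  have "I e \<le> of_nat DIM('a) * (\<integral>\<^sup>+v. indicator (ball (0::'a) 1 - {0}) v * ennreal 1 \<partial>lborel)"
    unfolding I by (intro mult_left_mono nn_integral_mono mult_left_mono[OF le1]) auto
  also have "\<dots> = (\<integral>\<^sup>+w. ennreal 1 \<partial>(sphere_measure :: 'a measure))"
    by (rule nn_integral_sphere_measure[symmetric]) simp
  also have "\<dots> < \<infinity>" by (rule finite_nn_integral_sphere_measure_const)
  finally have fin: "I e < \<infinity>" .
  have "kappa q TYPE('a) = enn2real (I e)"
    unfolding kappa_def Let_def e_def[symmetric] I_def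
    by (rule integral_eq_nn_integral) (auto simp: sphere_measure_def)
  then have Ie: "I e = ennreal (kappa q TYPE('a))"
    using fin by (simp add: less_top)
  have rot: "I h = I e" if h: "norm h = 1" for h
  proof -
    obtain T where T: "orthogonal_transformation T" "T e = h"
      using orthogonal_transformation_maps_unit_vectors[OF e h] .
    have n: "norm (T v) = norm v" for v
      using T(1) by (simp add: orthogonal_transformation_norm)
    have lin: "linear T" using T(1) by (rule orthogonal_transformation_linear)
    have "(h \<bullet> (T v /\<^sub>R norm (T v))) = e \<bullet> (v /\<^sub>R norm v)" for v
      using T by (auto simp: n orthogonal_transformation_def)
    moreover have "indicator (ball 0 1 - {0}) (T v) = (indicator (ball 0 1 - {0}) v :: ennreal)" for v
      using n[of v] by (auto simp: indicator_def)
    moreover have "(\<lambda>v. indicator (ball 0 1 - {0}) v * ennreal (\<bar>h \<bullet> (v /\<^sub>R norm v)\<bar> powr q)) \<in> borel_measurable borel"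
      by (intro borel_measurable_times_ennreal borel_measurable_indicator) auto
    ultimately show ?thesis
      unfolding I
      by (subst nn_integral_lborel_orthogonal_transformation[OF _ T(1), symmetric])
         (simp_all del: inner_scaleR_right)
  qed
  have scale: "I (c *\<^sub>R h) = ennreal (\<bar>c\<bar> powr q) * I h" for c h
  proof -
    have "I (c *\<^sub>R h) = (\<integral>\<^sup>+w. ennreal (\<bar>c\<bar> powr q) * ennreal (\<bar>h \<bullet> w\<bar> powr q) \<partial>sphere_measure)"
      unfolding I_def
      by (rule nn_integral_cong) (simp add: abs_mult powr_mult ennreal_mult[symmetric])
    also have "\<dots> = ennreal (\<bar>c\<bar> powr q) * I h"
      unfolding I_def by (rule nn_integral_cmult) (simp add: sphere_measure_def)
    finally show ?thesis .
  qed
  have "I g = ennreal (norm g powr q) * I e"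
  proof (cases "g = 0")
    case True
    then show ?thesis by (simp add: I_def)
  next
    case False
    then show ?thesis
      using scale[of "norm g" "g /\<^sub>R norm g"] rot[of "g /\<^sub>R norm g"] by simp
  qed
  then show ?thesis
    unfolding I_def[symmetric] Ie by (simp add: ennreal_mult' kappa_nonneg mult.commute)
qed

section \<open>Homogeneity and a Fatou lemma for the quasi-norm\<close>

text \<open>The axiom speaks of functions with finite quasi-norm. If \<open>N f\<close> is infinite,
  a finite value at \<open>c * f\<close> would, after scaling back by \<open>inverse c\<close>, make
  \<open>N f\<close> finite.\<close>

lemma ball_qBfs_cmult:
  assumes X: "ball_qBfs N" and f: "f \<in> meas_funs" and c: "c \<noteq> 0"
  shows "N (\<lambda>x. c * f x) = ennreal \<bar>c\<bar> * N f"
proof -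
  have hom: "N (\<lambda>x. c * f x) = ennreal \<bar>c\<bar> * N f" if "f \<in> qspace N" for f c
    using X that unfolding ball_qBfs_def by blast
  have cf: "(\<lambda>x. c * f x) \<in> meas_funs"
    using f unfolding meas_funs_def by measurable
  show ?thesis
  proof (cases "N f < \<infinity>")
    case True
    then show ?thesis using f hom by (simp add: qspace_def)
  next
    case False
    have "N (\<lambda>x. c * f x) = \<infinity>"
    proof (rule ccontr)
      assume "N (\<lambda>x. c * f x) \<noteq> \<infinity>"
      then have fin: "N (\<lambda>x. c * f x) < \<infinity>" by (simp add: less_top)
      then have "N (\<lambda>x. inverse c * (c * f x)) = ennreal \<bar>inverse c\<bar> * N (\<lambda>x. c * f x)"
        using cf by (intro hom) (simp add: qspace_def)
      also have "\<dots> < \<infinity>" using fin by (simp add: ennreal_mult_less_top)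
      finally show False using c False by (simp add: mult.assoc[symmetric])
    qed
    moreover have "N f = \<infinity>" using False by (metis infinity_ennreal_def top.not_eq_extremum)
    ultimately show ?thesis using c by (simp add: ennreal_mult_top)
  qed
qed

text \<open>The tail infima of \<open>H\<close>, truncated at \<open>g\<close>, increase to
  \<open>g\<close>, so axiom (3) applies to them, and axiom (2) compares each with
  \<open>H m\<close>. Truncation makes the limit exactly \<open>g\<close> and keeps it real-valued
  even where the lower limit of \<open>H k x\<close> is larger or infinite. The assumption
  \<open>lower\<close> says that \<open>g\<close> is at most this lower limit, without extended
  reals.\<close>

lemma ball_qBfs_Fatou:
  assumes X: "ball_qBfs N"
    and H: "\<And>k. H k \<in> meas_funs" "\<And>k x. 0 \<le> H k x"
    and g: "g \<in> meas_funs" "\<And>x. 0 \<le> g x"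
    and lower: "\<And>x y. y < g x \<Longrightarrow> eventually (\<lambda>k. y < H k x) sequentially"
  shows "N g \<le> liminf (\<lambda>k. N (H k))"
proof -
  define h where "h m x = min (g x) (INF k\<in>{m..}. H k x)" for m :: nat and x
  have bdd: "bdd_below ((\<lambda>k. H k x) ` A)" for x A
    using H(2) by (intro bdd_belowI2[where m=0])
  have h_meas: "h m \<in> meas_funs" for m
    using g(1) H(1) unfolding h_def meas_funs_def by measurable
  have h_nonneg: "0 \<le> h m x" for m x
    unfolding h_def using g(2) H(2) by (auto intro!: cINF_greatest)
  have h_mono: "h m x \<le> h (Suc m) x" for m x
    unfolding h_def by (intro min.mono order_refl cINF_superset_mono bdd) auto
  have h_lim: "(\<lambda>m. h m x) \<longlonglongrightarrow> g x" for x
  proof (rule increasing_tendsto)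
    show "eventually (\<lambda>m. h m x \<le> g x) sequentially" by (simp add: h_def)
    fix y assume "y < g x"
    \<comment> \<open>The infimum over a tail inherits just a weak inequality, so an intermediate
      \<open>z\<close> is inserted to recover the strict one.\<close>
    then obtain z where z: "y < z" "z < g x" using dense by blast
    from lower[OF z(2)] obtain M where "z < H k x" if "M \<le> k" for k
      by (auto simp: eventually_sequentially)
    then have "z \<le> (INF k\<in>{m..}. H k x)" if "M \<le> m" for m
      using that by (intro cINF_greatest) (auto intro: less_imp_le)
    then show "eventually (\<lambda>m. y < h m x) sequentially"
      unfolding eventually_sequentially h_def using z by fastforce
  qed
  have "(\<lambda>m. N (h m)) \<longlonglongrightarrow> N g"
    using X h_meas g(1) h_nonneg h_mono h_lim unfolding ball_qBfs_def by simp
  then have "N g = liminf (\<lambda>m. N (h m))"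
    by (rule lim_imp_Liminf[OF trivial_limit_sequentially, symmetric])
  also have "\<dots> \<le> liminf (\<lambda>m. N (H m))"
  proof (intro Liminf_mono always_eventually allI)
    fix m
    have "\<bar>h m x\<bar> \<le> \<bar>H m x\<bar>" for x
    proof -
      have "(INF k\<in>{m..}. H k x) \<le> H m x" by (rule cINF_lower[OF bdd]) simp
      then show ?thesis using h_nonneg[of m x] by (simp add: h_def)
    qed
    then show "N (h m) \<le> N (H m)"
      using X h_meas H(1) unfolding ball_qBfs_def by simp
  qed
  finally show ?thesis .
qed

section \<open>Measurability, rescaling and pointwise lower limit of \<open>Efun\<close>\<close>

lemma borel_measurable_Efun:
  fixes f :: "'a::euclidean_space \<Rightarrow> real"
  assumes [measurable]: "f \<in> borel_measurable borel"
  shows "Efun lam gam q f \<in> borel_measurable borel"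
proof -
  \<comment> \<open>Membership in \<open>Eset\<close> becomes a conditional, which exhibits joint
    measurability in both variables.\<close>
  have eq: "indicator (Eset lam (gam / q) f) (x, y) * ennreal (norm (x - y) powr (gam - real DIM('a)))
    = (if x \<noteq> y \<and> lam < \<bar>f x - f y\<bar> / norm (x - y) powr (1 + gam / q)
       then ennreal (norm (x - y) powr (gam - real DIM('a))) else 0)" for x y
    by (simp add: Eset_def indicator_def)
  show ?thesis
    unfolding Efun_def eq by measurable
qed

text \<open>Under y = x + t u the Jacobian t^n and the weight contribute t^gam, whose q-th root
  cancels the factor lam = t^(-gam/q). In the defining inequality, lam |t u|^(1 + gam/q) = t |u|^(1
  + gam/q), which leaves a difference quotient on the other side.\<close>

lemma Efun_rescaled:
  fixes f :: "'a::euclidean_space \<Rightarrow> real"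
  assumes [measurable]: "f \<in> borel_measurable borel" and q: "0 < q" and gam: "gam \<noteq> 0" and t: "0 < t"
  shows "t powr (- gam / q) * Efun (t powr (- gam / q)) gam q f x
    = enn2real (\<integral>\<^sup>+u. (if norm u powr (1 + gam / q) < \<bar>f (x + t *\<^sub>R u) - f x\<bar> / t
          then ennreal (norm u powr (gam - real DIM('a))) else 0) \<partial>lborel) powr (1 / q)"
proof -
  define n where "n = DIM('a)"
  define lam where "lam = t powr (- gam / q)"
  have lam: "0 < lam" using t by (simp add: lam_def)
  define F where "F y = (if x \<noteq> y \<and> lam < \<bar>f x - f y\<bar> / norm (x - y) powr (1 + gam / q)
     then ennreal (norm (x - y) powr (gam - real n)) else 0)" for y
  have [measurable]: "F \<in> borel_measurable borel" unfolding F_def by measurable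
  define J where "J = (\<lambda>u::'a. if norm u powr (1 + gam / q) < \<bar>f (x + t *\<^sub>R u) - f x\<bar> / t
          then ennreal (norm u powr (gam - real n)) else 0)"
  have [measurable]: "J \<in> borel_measurable borel" unfolding J_def by measurable
  have FJ: "ennreal (t ^ n) * F (x + t *\<^sub>R u) = ennreal (t powr gam) * J u" for u
  \<comment> \<open>At \<open>u = 0\<close> the condition in \<open>J\<close> reads 0 < 0, matching
    the exclusion of \<open>x = y\<close> in \<open>F\<close>.\<close>
  proof (cases "u = 0")
    case True
    then show ?thesis using t by (simp add: F_def J_def)
  next
    case False
    have "lam * (norm (t *\<^sub>R u) powr (1 + gam / q)) = t * norm u powr (1 + gam / q)"
      using t by (simp add: lam_def powr_mult powr_add[symmetric] mult.assoc[symmetric] powr_one)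
    then have "lam < \<bar>f (x + t *\<^sub>R u) - f x\<bar> / norm (t *\<^sub>R u) powr (1 + gam / q)
       \<longleftrightarrow> norm u powr (1 + gam / q) < \<bar>f (x + t *\<^sub>R u) - f x\<bar> / t"
      using t False by (simp add: pos_less_divide_eq mult.commute del: norm_scaleR)
    moreover have "t ^ n * norm (t *\<^sub>R u) powr (gam - real n) = t powr gam * norm u powr (gam - real n)"
      using t by (simp add: powr_mult powr_realpow[symmetric] powr_add[symmetric] mult.assoc[symmetric])
    ultimately show ?thesis
      using t False by (simp add: F_def J_def abs_minus_commute ennreal_mult[symmetric] del: norm_scaleR)
  qed
  have "(\<integral>\<^sup>+y. F y \<partial>lborel) = ennreal (t ^ n) * (\<integral>\<^sup>+u. F (x + t *\<^sub>R u) \<partial>lborel)"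
    using t by (subst nn_integral_lborel_affine[where c=t and t=x]) (simp_all add: n_def)
  also have "\<dots> = (\<integral>\<^sup>+u. ennreal (t powr gam) * J u \<partial>lborel)"
    by (subst nn_integral_cmult[symmetric]) (simp_all add: FJ)
  also have "\<dots> = ennreal (t powr gam) * (\<integral>\<^sup>+u. J u \<partial>lborel)"
    by (rule nn_integral_cmult) measurable
  finally have F: "(\<integral>\<^sup>+y. F y \<partial>lborel) = ennreal (t powr gam) * (\<integral>\<^sup>+u. J u \<partial>lborel)" .
  have "Efun lam gam q f x = enn2real (\<integral>\<^sup>+y. F y \<partial>lborel) powr (1 / q)"
    unfolding Efun_def F_def n_def
    by (intro arg_cong[where f="\<lambda>z. enn2real z powr (1 / q)"] nn_integral_cong)
       (simp add: Eset_def indicator_def)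
  also have "\<dots> = t powr (gam / q) * enn2real (\<integral>\<^sup>+u. J u \<partial>lborel) powr (1 / q)"
    using t by (simp add: F enn2real_mult powr_mult powr_powr)
  finally have "lam * Efun lam gam q f x = enn2real (\<integral>\<^sup>+u. J u \<partial>lborel) powr (1 / q)"
    using t by (simp add: lam_def mult.assoc[symmetric] powr_add[symmetric])
  then show ?thesis unfolding lam_def J_def n_def .
qed

text \<open>Difference quotients along \<open>t k\<close> tend to |u . g|, so Fatou's lemma bounds
  the lower limit of the rescaled integrals from below by the superlevel integral of |g . w|. The
  bound \<open>Lip\<close> keeps these integrals finite. The conclusion has the form of the
  assumption \<open>lower\<close> in \<open>ball_qBfs_Fatou\<close>.\<close>

lemma Efun_pointwise_liminf:
  fixes f :: "'a::euclidean_space \<Rightarrow> real"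
  assumes f: "f \<in> borel_measurable borel" and q: "0 < q" and gam: "gam \<noteq> 0"
    and grad: "GDERIV f x :> g"
    and Lip: "\<And>y. \<bar>f y - f x\<bar> \<le> L * norm (y - x)"
    and t: "\<And>k. 0 < t k" "t \<longlonglongrightarrow> 0"
    and y: "y < (kappa q TYPE('a) / \<bar>gam\<bar>) powr (1 / q) * norm g"
  shows "eventually (\<lambda>k. y < t k powr (- gam / q) * Efun (t k powr (- gam / q)) gam q f x) sequentially"
proof -
  note [measurable] = f
  define n where "n = real DIM('a)"
  define J where "J k u = (if norm u powr (1 + gam / q) < \<bar>f (x + t k *\<^sub>R u) - f x\<bar> / t k
          then ennreal (norm u powr (gam - n)) else 0)" for k and u :: 'a
  have [measurable]: "J k \<in> borel_measurable borel" for k unfolding J_def by measurable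
  \<comment> \<open>Dividing by \<open>norm u\<close> leaves a right-hand side that, for linear
    \<open>a\<close>, depends on the direction of \<open>u\<close> alone, as polar coordinates
    require.\<close>
  have split_powr: "norm u powr (1 + gam / q) < a \<longleftrightarrow> norm u powr (gam / q) < a / norm u"
    if "u \<noteq> 0" for u :: 'a and a
    using that by (simp add: powr_add field_simps)
  have level: "(\<integral>\<^sup>+u. indicator {u. norm u powr (gam / q) < \<theta> (u /\<^sub>R norm u)} u
            * ennreal (norm u powr (gam - n)) \<partial>lborel)
      = ennreal (1 / \<bar>gam\<bar>) * (\<integral>\<^sup>+w. ennreal (\<theta> w powr q) \<partial>sphere_measure)"
    if "\<theta> \<in> borel_measurable borel" "\<And>w. 0 \<le> \<theta> w" for \<theta> :: "'a \<Rightarrow> real"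
    unfolding n_def by (rule nn_integral_homogeneous_superlevel[OF q gam that])
  have L: "0 \<le> L"
  proof -
    obtain b :: 'a where "b \<in> Basis" using nonempty_Basis by blast
    then show ?thesis using Lip[of "x + b"] by simp
  qed
  \<comment> \<open>Without finiteness, enn2real would collapse the integral to 0 and the lower bound would be lost.\<close>
  have J_fin: "(\<integral>\<^sup>+u. J k u \<partial>lborel) < \<infinity>" for k
  proof -
    have "(\<integral>\<^sup>+u. J k u \<partial>lborel) \<le> (\<integral>\<^sup>+u. indicator {u::'a. norm u powr (gam / q) < L} u
            * ennreal (norm u powr (gam - n)) \<partial>lborel)"
    proof (rule nn_integral_mono)
      fix u :: 'a
      have "norm u powr (gam / q) < L" if *: "norm u powr (1 + gam / q) < \<bar>f (x + t k *\<^sub>R u) - f x\<bar> / t k"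
      proof -
        have u: "u \<noteq> 0" using * by auto
        have "\<bar>f (x + t k *\<^sub>R u) - f x\<bar> / t k \<le> L * norm u"
          using Lip[of "x + t k *\<^sub>R u"] t(1)[of k] by (simp add: field_simps)
        then have "norm u powr (1 + gam / q) < L * norm u" using * by linarith
        then show ?thesis using u by (simp add: split_powr)
      qed
      then show "J k u \<le> indicator {u::'a. norm u powr (gam / q) < L} u * ennreal (norm u powr (gam - n))"
        by (auto simp: J_def)
    qed
    also have "\<dots> = ennreal (1 / \<bar>gam\<bar>) * (\<integral>\<^sup>+w. ennreal (L powr q) \<partial>(sphere_measure :: 'a measure))"
      using level[of "\<lambda>_. L"] L by simp
    also have "\<dots> < \<infinity>"
      using finite_nn_integral_sphere_measure_const[where 'a='a, of "L powr q"]
      by (auto simp: ennreal_mult_less_top simp del: nn_integral_const)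
    finally show ?thesis .
  qed
  have J_pt: "indicator {u. norm u powr (gam / q) < \<bar>g \<bullet> (u /\<^sub>R norm u)\<bar>} u * ennreal (norm u powr (gam - n))
      \<le> liminf (\<lambda>k. J k u)" for u
  proof (cases "norm u powr (gam / q) < \<bar>g \<bullet> (u /\<^sub>R norm u)\<bar>")
    case True
    then have u: "u \<noteq> 0" by auto
    have "((\<lambda>s. f (x + s *\<^sub>R u)) has_derivative (\<lambda>s. (s *\<^sub>R u) \<bullet> g)) (at 0)"
    proof -
      have "((\<lambda>s. x + s *\<^sub>R u) has_derivative (\<lambda>s. s *\<^sub>R u)) (at 0)"
        by (auto intro!: derivative_eq_intros)
      moreover have "(f has_derivative (\<lambda>h. h \<bullet> g)) (at (x + 0 *\<^sub>R u))"
        using grad by (simp add: gderiv_def)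
      ultimately show ?thesis by (rule has_derivative_compose)
    qed
    then have "((\<lambda>s. f (x + s *\<^sub>R u)) has_field_derivative (u \<bullet> g)) (at 0)"
      by (simp add: has_field_derivative_def mult_commute_abs)
    then have "((\<lambda>s. (f (x + s *\<^sub>R u) - f x) / s) \<longlongrightarrow> u \<bullet> g) (at 0)"
      by (simp add: has_field_derivative_iff)
    moreover have "filterlim t (at 0) sequentially"
      using t(2) less_imp_neq[OF t(1)] by (simp add: filterlim_at)
    ultimately have quot: "(\<lambda>k. (f (x + t k *\<^sub>R u) - f x) / t k) \<longlonglongrightarrow> u \<bullet> g"
      by (rule filterlim_compose)
    have lim: "(\<lambda>k. \<bar>f (x + t k *\<^sub>R u) - f x\<bar> / t k) \<longlonglongrightarrow> \<bar>u \<bullet> g\<bar>"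
      using tendsto_rabs[OF quot] by (simp add: abs_of_pos[OF t(1)])
    have "norm u powr (1 + gam / q) < \<bar>u \<bullet> g\<bar>"
    proof -
      have "\<bar>g \<bullet> (u /\<^sub>R norm u)\<bar> = \<bar>u \<bullet> g\<bar> / norm u"
        by (simp add: inner_commute abs_mult divide_inverse mult.commute)
      then show ?thesis using True by (simp add: split_powr[OF u])
    qed
    \<comment> \<open>The limit strictly exceeds the threshold, hence so do the quotients for all
      large \<open>k\<close>.\<close>
    then have "eventually (\<lambda>k. norm u powr (1 + gam / q) < \<bar>f (x + t k *\<^sub>R u) - f x\<bar> / t k) sequentially"
      by (rule order_tendstoD(1)[OF lim])
    then have "eventually (\<lambda>k. ennreal (norm u powr (gam - n)) \<le> J k u) sequentially"
      by eventually_elim (simp add: J_def)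
    then have "ennreal (norm u powr (gam - n)) \<le> liminf (\<lambda>k. J k u)"
      by (rule Liminf_bounded)
    then show ?thesis using True by simp
  qed simp
  define c where "c = kappa q TYPE('a) / \<bar>gam\<bar> * norm g powr q"
  have c0: "0 \<le> c" by (simp add: c_def kappa_nonneg)
  have "ennreal c = ennreal (1 / \<bar>gam\<bar>) * ennreal (kappa q TYPE('a) * norm g powr q)"
    by (simp add: c_def ennreal_mult[symmetric] kappa_nonneg)
  also have "\<dots> = (\<integral>\<^sup>+u. indicator {u. norm u powr (gam / q) < \<bar>g \<bullet> (u /\<^sub>R norm u)\<bar>} u
            * ennreal (norm u powr (gam - n)) \<partial>lborel)"
    using level[of "\<lambda>w. \<bar>g \<bullet> w\<bar>"] nn_integral_sphere_measure_inner[OF q, of g] by simp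
  also have "\<dots> \<le> (\<integral>\<^sup>+u. liminf (\<lambda>k. J k u) \<partial>lborel)"
    by (rule nn_integral_mono) (rule J_pt)
  also have "\<dots> \<le> liminf (\<lambda>k. \<integral>\<^sup>+u. J k u \<partial>lborel)"
    by (rule nn_integral_liminf) simp
  finally have c_le: "ennreal c \<le> liminf (\<lambda>k. \<integral>\<^sup>+u. J k u \<partial>lborel)" .
  have H: "t k powr (- gam / q) * Efun (t k powr (- gam / q)) gam q f x
      = enn2real (\<integral>\<^sup>+u. J k u \<partial>lborel) powr (1 / q)" for k
    unfolding J_def n_def by (rule Efun_rescaled[OF f q gam t(1)])
  show ?thesis
  \<comment> \<open>Monotonicity of \<open>y powr q\<close> requires \<open>y \<ge> 0\<close>; a
    negative \<open>y\<close> lies below every value of the nonnegative root.\<close>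
  proof (cases "y < 0")
    case True
    have "y < enn2real z powr (1 / q)" for z
      using True powr_ge_zero[of "enn2real z" "1 / q"] by linarith
    then show ?thesis unfolding H by simp
  next
    case False
    have "y powr q < ((kappa q TYPE('a) / \<bar>gam\<bar>) powr (1 / q) * norm g) powr q"
      using y q False by (intro powr_less_mono2) auto
    also have "\<dots> = c"
      using q by (simp add: c_def powr_mult powr_powr kappa_nonneg)
    finally have "ennreal (y powr q) < ennreal c"
      by (simp add: ennreal_lessI le_less_trans[OF powr_ge_zero])
    then have "eventually (\<lambda>k. ennreal (y powr q) < (\<integral>\<^sup>+u. J k u \<partial>lborel)) sequentially"
      using c_le by (simp add: le_Liminf_iff)
    then show ?thesis
    proof eventually_elim
      case (elim k)
      obtain r where r: "0 \<le> r" "(\<integral>\<^sup>+u. J k u \<partial>lborel) = ennreal r"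
        using J_fin[of k] by (cases "\<integral>\<^sup>+u. J k u \<partial>lborel") auto
      have "y powr q < enn2real (\<integral>\<^sup>+u. J k u \<partial>lborel)"
        using elim r by (simp add: ennreal_less_iff)
      then have "(y powr q) powr (1 / q) < enn2real (\<integral>\<^sup>+u. J k u \<partial>lborel) powr (1 / q)"
        using q by (intro powr_less_mono2) auto
      then show ?case using False q unfolding H by (simp add: powr_powr)
    qed
  qed
qed

section \<open>Passage from the pointwise bound to the quasi-norm\<close>

lemma bounded_gradient_imp_Lipschitz:
  fixes f :: "'a::euclidean_space \<Rightarrow> real"
  assumes grad: "\<And>x. GDERIV f x :> G x" and G: "\<And>x. norm (G x) \<le> L"
  shows "\<bar>f y - f x\<bar> \<le> L * norm (y - x)"
proof -
  have "norm (f y - f x) \<le> L * norm (y - x)"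
  proof (rule differentiable_bound[where S=UNIV])
    fix z :: 'a
    show "(f has_derivative (\<lambda>h. h \<bullet> G z)) (at z within UNIV)"
      using grad by (simp add: gderiv_def)
    show "onorm (\<lambda>h. h \<bullet> G z) \<le> L"
    proof (rule onorm_bound)
      show "0 \<le> L" using G[of z] norm_ge_zero order_trans by blast
      fix h
      have "norm (h \<bullet> G z) \<le> norm h * norm (G z)"
        by (simp add: Cauchy_Schwarz_ineq2)
      also have "\<dots> \<le> norm h * L" by (intro mult_left_mono G) simp
      finally show "norm (h \<bullet> G z) \<le> L * norm h" by (simp add: mult.commute)
    qed
  qed auto
  then show ?thesis by simp
qed

text \<open>The Fatou property is sequential, so the filter at 0 from the right is tested along
  arbitrary sequences \<open>t k\<close>. Along each one the pointwise bound feeds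
  \<open>ball_qBfs_Fatou\<close>, and homogeneity moves the constants out of
  \<open>N\<close>.\<close>

lemma eventually_Efun_lower_bound:
  fixes N :: "('a::euclidean_space \<Rightarrow> real) \<Rightarrow> ennreal"
  assumes X: "ball_qBfs N" and q: "0 < q" and gam: "gam \<noteq> 0"
    and grad: "\<And>x. GDERIV f x :> G x" and C1: "continuous_on UNIV G"
    and L: "\<And>x. norm (G x) \<le> L"
    and y: "y < ennreal ((kappa q TYPE('a) / \<bar>gam\<bar>) powr (1 / q)) * N (\<lambda>x. norm (G x))"
  shows "eventually (\<lambda>t. y < ennreal (t powr (- gam / q)) * N (Efun (t powr (- gam / q)) gam q f)) (at_right 0)"
proof (rule sequentially_imp_eventually_at_right[of 0 1])
  show "(0::real) < 1" by simp
  fix t :: "nat \<Rightarrow> real"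
  assume t: "\<And>k. 0 < t k" "t \<longlonglongrightarrow> 0"
  define c where "c = (kappa q TYPE('a) / \<bar>gam\<bar>) powr (1 / q)"
  define lam where "lam k = t k powr (- gam / q)" for k
  have lam: "0 < lam k" for k using t(1)[of k] by (simp add: lam_def)
  have "continuous_on UNIV f"
    using grad by (intro continuous_at_imp_continuous_on ballI) (auto simp: gderiv_def intro: has_derivative_continuous)
  then have f: "f \<in> borel_measurable borel" by (rule borel_measurable_continuous_onI)
  have lebesgue: "h \<in> meas_funs" if "h \<in> borel_measurable borel" for h :: "'a \<Rightarrow> real"
    using that unfolding meas_funs_def by (intro measurable_completion) simp
  have G_borel: "(\<lambda>x. norm (G x)) \<in> borel_measurable borel"
    using C1 by (intro borel_measurable_continuous_onI continuous_intros)
  have E_borel: "Efun (lam k) gam q f \<in> borel_measurable borel" for k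
    by (rule borel_measurable_Efun[OF f])
  have Lip: "\<bar>f z - f x\<bar> \<le> L * norm (z - x)" for x z
    by (rule bounded_gradient_imp_Lipschitz[OF grad L])
  have "N (\<lambda>x. c * norm (G x)) \<le> liminf (\<lambda>k. N (\<lambda>x. lam k * Efun (lam k) gam q f x))"
  proof (rule ball_qBfs_Fatou[OF X])
    show "(\<lambda>x. lam k * Efun (lam k) gam q f x) \<in> meas_funs" for k
      using E_borel by (intro lebesgue) simp
    show "0 \<le> lam k * Efun (lam k) gam q f x" for k x
      using lam[of k] by (simp add: Efun_def)
    show "(\<lambda>x. c * norm (G x)) \<in> meas_funs"
      using G_borel by (intro lebesgue) simp
    show "0 \<le> c * norm (G x)" for x by (simp add: c_def)
    show "eventually (\<lambda>k. z < lam k * Efun (lam k) gam q f x) sequentially"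
      if "z < c * norm (G x)" for x z
      unfolding lam_def
      by (rule Efun_pointwise_liminf[OF f q gam grad Lip t]) (use that in \<open>simp add: c_def\<close>)
  qed
  moreover have "N (\<lambda>x. lam k * Efun (lam k) gam q f x) = ennreal (lam k) * N (Efun (lam k) gam q f)" for k
    using ball_qBfs_cmult[OF X lebesgue[OF E_borel], of "lam k" k] lam[of k] by simp
  moreover have "y < N (\<lambda>x. c * norm (G x))"
  \<comment> \<open>Homogeneity is available for nonzero factors; if \<open>c = 0\<close>, the
    assumption on \<open>y\<close> reads y < 0, impossible in \<open>ennreal\<close>.\<close>
  proof (cases "c = 0")
    case True
    then show ?thesis using y unfolding c_def[symmetric] by simp
  next
    case False
    then show ?thesis
      using y ball_qBfs_cmult[OF X lebesgue[OF G_borel] False] by (simp add: c_def)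
  qed
  ultimately show "eventually (\<lambda>k. y < ennreal (t k powr (- gam / q)) * N (Efun (t k powr (- gam / q)) gam q f)) sequentially"
    by (simp add: le_Liminf_iff lam_def)
qed

lemma Efun_Liminf:
  fixes N :: "('a::euclidean_space \<Rightarrow> real) \<Rightarrow> ennreal"
  assumes "ball_qBfs N" and q: "0 < q" and gam: "gam \<noteq> 0"
    and "\<And>x. GDERIV f x :> G x" and "continuous_on UNIV G" and "\<And>x. norm (G x) \<le> L"
    and F: "filterlim (\<lambda>lam. lam powr (- q / gam)) (at_right 0) F" "eventually (\<lambda>lam. 0 < lam) F"
  shows "ennreal ((kappa q TYPE('a) / \<bar>gam\<bar>) powr (1 / q)) * N (\<lambda>x. norm (G x))
    \<le> Liminf F (\<lambda>lam. ennreal lam * N (Efun lam gam q f))"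
  unfolding le_Liminf_iff
proof (intro allI impI)
  fix y assume "y < ennreal ((kappa q TYPE('a) / \<bar>gam\<bar>) powr (1 / q)) * N (\<lambda>x. norm (G x))"
  from eventually_compose_filterlim[OF eventually_Efun_lower_bound[OF assms(1-6) this] F(1)] F(2)
  show "eventually (\<lambda>lam. y < ennreal lam * N (Efun lam gam q f)) F"
  proof eventually_elim
    case (elim lam)
    have "(lam powr (- q / gam)) powr (- gam / q) = lam"
      using elim(2) q gam by (simp add: powr_powr)
    then show ?case using elim(1) by simp
  qed
qed

theorem theorem3p19:
  fixes N :: "('a::euclidean_space \<Rightarrow> real) \<Rightarrow> ennreal"
    and q gam :: real
    and f :: "'a \<Rightarrow> real"
    and G :: "'a \<Rightarrow> 'a"
  assumes X: "ball_qBfs N"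
    and q: "0 < q"
    and gam: "gam \<noteq> 0"
    and grad: "\<forall>x. GDERIV f x :> G x"
    and C1: "continuous_on UNIV G"
    and supp: "compact (closure {x. G x \<noteq> 0})"
  shows "(0 < gam \<longrightarrow>
           Liminf at_top (\<lambda>lam. ennreal lam * N (Efun lam gam q f))
             \<ge> ennreal ((kappa q TYPE('a) / gam) powr (1 / q)) * N (\<lambda>x. norm (G x)))
       \<and> (gam < 0 \<longrightarrow>
           Liminf (at_right 0) (\<lambda>lam. ennreal lam * N (Efun lam gam q f))
             \<ge> ennreal ((- kappa q TYPE('a) / gam) powr (1 / q)) * N (\<lambda>x. norm (G x)))"
proof -
  \<comment> \<open>Continuity on the compact support bounds the gradient there;
    \<open>0 < L\<close> extends the bound to points where \<open>G\<close> vanishes.\<close>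
  have "bounded (G ` closure {x. G x \<noteq> 0})"
    using C1 supp continuous_on_subset by (intro compact_imp_bounded compact_continuous_image) auto
  then obtain L where L: "0 < L" "\<And>x. x \<in> closure {x. G x \<noteq> 0} \<Longrightarrow> norm (G x) \<le> L"
    unfolding bounded_pos by blast
  have bound: "norm (G x) \<le> L" for x
    using L closure_subset[of "{x. G x \<noteq> 0}"] by (cases "G x = 0") auto
  note main = Efun_Liminf[OF X q gam grad[rule_format] C1 bound]
  show ?thesis
  proof (intro conjI impI)
    assume g: "0 < gam"
    \<comment> \<open>Here the exponent -q/gam is negative, so t tends to 0 as lam tends to
      infinity.\<close>
    have "filterlim (\<lambda>lam. lam powr (- q / gam)) (at_right 0) at_top"
      using g q
      by (intro tendsto_imp_filterlim_at_right tendsto_neg_powr filterlim_ident eventually_mono[OF eventually_gt_at_top[of 0]])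
         (simp_all add: divide_neg_pos)
    from main[OF this eventually_gt_at_top]
    show "Liminf at_top (\<lambda>lam. ennreal lam * N (Efun lam gam q f))
             \<ge> ennreal ((kappa q TYPE('a) / gam) powr (1 / q)) * N (\<lambda>x. norm (G x))"
      using g by simp
  next
    assume g: "gam < 0"
    \<comment> \<open>Here the exponent -q/gam is positive, so t and lam tend to 0 together.\<close>
    have "filterlim (\<lambda>lam. lam powr (- q / gam)) (at_right 0) (at_right 0)"
      using g q
      by (intro tendsto_imp_filterlim_at_right tendsto_zero_powrI[OF tendsto_ident_at tendsto_const]
          eventually_mono[OF eventually_at_right_less[of 0]])
         (simp_all add: divide_pos_neg)
    from main[OF this eventually_at_right_less]
    show "Liminf (at_right 0) (\<lambda>lam. ennreal lam * N (Efun lam gam q f))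
             \<ge> ennreal ((- kappa q TYPE('a) / gam) powr (1 / q)) * N (\<lambda>x. norm (G x))"
      using g by simp
  qed
qed

end
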